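(* Let $S$ be a symmetric (respectively, pseudo-symmetric) numerical semigroup with set of gaps $G$ and Frobenius number $F$, and let $P(z)$ be a gap polynomial (respectively, a pseudo-gap polynomial) of $S$, with complex coefficients. Let $r_1, \ldots, r_{F-1} \in \mathbb{C}$ be the critical points of $P$ (the roots of $P'$), counted with multiplicity. Then the sum of the critical values of $P$ vanishes: $$\sum_{i=1}^{F-1} P(r_i) = 0.$$
   Context: A numerical semigroup $S$ is a set of non-negative integers that is closed under addition and contains $0$ and all but finitely many natural numbers. Its set of gaps $G$ is the (finite) set of non-negative integers not in $S$; $G$ is assumed nonempty, and the Frobenius number $F$ is the largest gap. $S$ is symmetric if $i \in G$ implies $F - i \in S$ (this forces $F$ to be odd). $S$ is pseudo-symmetric if $F$ is even and $i \in G$, $i \neq F/2$ implies $F - i \in S$. If $F$ is odd, a gap polynomial of $S$ is a polynomial of the form $P(z) = \sum_{g \in G} c_g z^g$ with $c_F \neq 0$. If $F$ is even, a pseudo-gap polynomial of $S$ is a polynomial of the form $P(z) = \sum_{g \in G,\, g \neq F/2} c_g z^g$ with $c_F \neq 0$. The coefficients $c_g$ are complex numbers. *)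

theory Defs
  imports Complex_Main "HOL-Computational_Algebra.Computational_Algebra"
begin

definition numerical_semigroup :: "nat set \<Rightarrow> bool" where
  "numerical_semigroup S \<longleftrightarrow>
     0 \<in> S \<and> (\<forall>a\<in>S. \<forall>b\<in>S. a + b \<in> S) \<and> finite (UNIV - S)"

definition gaps :: "nat set \<Rightarrow> nat set" where
  "gaps S = UNIV - S"

text \<open>Only meaningful when the set of gaps is finite and nonempty.\<close>

definition Frobenius :: "nat set \<Rightarrow> nat" where
  "Frobenius S = Max (gaps S)"

text \<open>The subtractions below never truncate, since every gap is at most the Frobenius number.\<close>

definition symmetric_semigroup :: "nat set \<Rightarrow> bool" where
  "symmetric_semigroup S \<longleftrightarrow> (\<forall>i\<in>gaps S. Frobenius S - i \<in> S)"

definition pseudo_symmetric_semigroup :: "nat set \<Rightarrow> bool" where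
  "pseudo_symmetric_semigroup S \<longleftrightarrow>
     even (Frobenius S) \<and>
     (\<forall>i\<in>gaps S. i \<noteq> Frobenius S div 2 \<longrightarrow> Frobenius S - i \<in> S)"

definition gap_polynomial :: "nat set \<Rightarrow> complex poly \<Rightarrow> bool" where
  "gap_polynomial S P \<longleftrightarrow>
     odd (Frobenius S) \<and>
     (\<exists>c. c (Frobenius S) \<noteq> 0 \<and> P = (\<Sum>g\<in>gaps S. monom (c g) g))"

definition pseudo_gap_polynomial :: "nat set \<Rightarrow> complex poly \<Rightarrow> bool" where
  "pseudo_gap_polynomial S P \<longleftrightarrow>
     even (Frobenius S) \<and>
     (\<exists>c. c (Frobenius S) \<noteq> 0 \<and>
          P = (\<Sum>g\<in>gaps S - {Frobenius S div 2}. monom (c g) g))"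

text \<open>The parity condition in \<^const>\<open>gap_polynomial\<close> is no restriction for
  symmetric semigroups.\<close>

lemma symmetric_semigroup_odd_Frobenius:
  assumes "numerical_semigroup S" "gaps S \<noteq> {}" "symmetric_semigroup S"
  shows "odd (Frobenius S)"
proof
  assume "even (Frobenius S)"
  then obtain k where k: "Frobenius S = k + k"
    by (metis evenE mult_2)
  have "Frobenius S \<in> gaps S"
    unfolding Frobenius_def using assms(1,2)
    by (intro Max_in) (auto simp: numerical_semigroup_def gaps_def)
  hence notin: "k + k \<notin> S"
    by (simp add: k gaps_def)
  hence "k \<in> gaps S"
    using assms(1) by (auto simp: numerical_semigroup_def gaps_def)
  moreover from this have "k \<in> S"
    using assms(3) k by (auto simp: symmetric_semigroup_def)
  ultimately show False
    by (simp add: gaps_def)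
qed

end

theory Submission
  imports Defs
begin

text \<open>
  Write $p_k = \sum_i r_i^k$ for the power sums of the critical points. Since
  $\sum_i P(r_i)$ is the linear combination $\sum_g c_g p_g$ over the gaps that occur in $P$,
  it suffices that \<^emph>\<open>every\<close> $p_g$ with $g$ a gap vanishes (theorem
  \<open>power_sum_proots_eq_0\<close>).

  The derivative $P'$ has degree $F - 1$ and involves only exponents $g - 1$ with $c_g \ne 0$.
  Reversing its coefficients turns these into $F - g$, which by (pseudo-)symmetry all lie in $S$. So the
  reversed polynomial $Q = c \prod_i (1 - r_i X)$ is supported on $S$. The power sums are read off
  its logarithmic derivative, $X Q' / Q = - \sum_{k \ge 1} p_k X^k$
  (lemma \<open>fps_deriv_prod_one_minus\<close>). The power series supported on $S$ form a ring because
  $S$ contains $0$ and is closed under addition, and this ring contains the quotient of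
  its members whenever the denominator has nonzero constant term; hence $X Q' / Q$ is supported
  on $S$ too (lemma \<open>fps_log_deriv_support\<close>), that is, $p_k = 0$ for $k \notin S$.
\<close>

text \<open>
  Each factor contributes a geometric series, and logarithmic derivatives turn products into
  sums. The equation is stated for $Q'$ rather than $X Q'$, so the coefficient at $k$ carries
  the power sum of exponent $k + 1$.
\<close>

lemma fps_deriv_prod_one_minus:
  fixes r :: "'i \<Rightarrow> 'a :: field"
  shows "fps_deriv (\<Prod>i\<in>A. 1 - fps_const (r i) * fps_X) =
           (\<Prod>i\<in>A. 1 - fps_const (r i) * fps_X) * Abs_fps (\<lambda>k. - (\<Sum>i\<in>A. r i ^ Suc k))"
proof (induction A rule: infinite_finite_induct)
  case (insert j A)
  let ?f = "1 - fps_const (r j) * fps_X"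
  let ?N = "\<lambda>A. Abs_fps (\<lambda>k. - (\<Sum>i\<in>A. r i ^ Suc k))"
  let ?g = "Abs_fps (\<lambda>k. - (r j ^ Suc k))"
  have geometric: "?f * ?g = fps_deriv ?f"
  proof (rule fps_ext)
    fix n
    show "(?f * ?g) $ n = fps_deriv ?f $ n"
      by (cases n) (simp_all add: left_diff_distrib mult.assoc)
  qed
  have "?N (insert j A) = ?g + ?N A"
    using insert.hyps by (intro fps_ext) simp
  moreover have "fps_deriv (?f * q) = ?f * q * (?g + m)" if "fps_deriv q = q * m" for q m
    unfolding fps_deriv_mult that geometric [symmetric] by (simp only: algebra_simps)
  ultimately show ?case
    using insert by (simp only: prod.insert not_False_eq_True)
qed (simp_all add: fps_eq_iff)

text \<open>
  Comparing coefficients in $Q' = Q T$ determines the $T_n$ recursively. The index shift by one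
  is that of $X Q' / Q = X T$. If $n + 1 \notin S$, then additive closure makes every product
  $Q_i T_{n-i}$ with $i \ge 1$ in the recursion vanish: $i$ or $n - i + 1$ lies outside $S$.
\<close>

lemma fps_log_deriv_support:
  fixes Q T :: "'a :: idom fps"
  assumes closed: "\<And>a b. a \<in> S \<Longrightarrow> b \<in> S \<Longrightarrow> a + b \<in> S"
    and supp: "\<And>n. n \<notin> S \<Longrightarrow> Q $ n = 0"
    and nz: "Q $ 0 \<noteq> 0"
    and log_deriv: "fps_deriv Q = Q * T"
  shows "Suc n \<notin> S \<Longrightarrow> T $ n = 0"
proof (induction n rule: less_induct)
  case (less n)
  have "(\<Sum>i=1..n. Q $ i * T $ (n - i)) = 0"
  proof (rule sum.neutral, rule ballI)
    fix i assume i: "i \<in> {1..n}"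
    hence "i + Suc (n - i) = Suc n"
      by simp
    hence "i \<notin> S \<or> Suc (n - i) \<notin> S"
      using closed less.prems by metis
    thus "Q $ i * T $ (n - i) = 0"
      using supp less.IH[of "n - i"] i by auto
  qed
  hence "(Q * T) $ n = Q $ 0 * T $ n"
    by (simp add: fps_mult_nth sum.atLeast_Suc_atMost)
  moreover have "(Q * T) $ n = 0"
    using supp[OF less.prems] by (simp flip: log_deriv)
  ultimately show ?case
    using nz by simp
qed

text \<open>
  The support condition is on the reversed coefficients of \<open>p\<close> because reversal turns the
  factors $X - r_i$ into $1 - r_i X$, whose logarithmic derivatives are power series in $X$ with
  the powers of $r_i$ as coefficients.
\<close>

theorem power_sum_proots_eq_0:
  fixes p :: "complex poly" and r :: "'i \<Rightarrow> complex"
  assumes roots: "image_mset r (mset_set A) = proots p"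
    and closed: "\<And>a b. a \<in> S \<Longrightarrow> b \<in> S \<Longrightarrow> a + b \<in> S"
    and supp: "\<And>n. n \<le> degree p \<Longrightarrow> n \<notin> S \<Longrightarrow> coeff p (degree p - n) = 0"
    and "p \<noteq> 0" "k \<notin> S" "k > 0"
  shows "(\<Sum>i\<in>A. r i ^ k) = 0"
proof -
  define Q where "Q = fps_of_poly (reflect_poly p)"
  define T where "T = Abs_fps (\<lambda>k. - (\<Sum>i\<in>A. r i ^ Suc k))"
  have "p = smult (lead_coeff p) (\<Prod>x\<in>#proots p. [:-x, 1:])"
    by (rule complex_poly_decompose_multiset [symmetric])
  also have "(\<Prod>x\<in>#proots p. [:-x, 1:]) = (\<Prod>i\<in>A. [:- r i, 1:])"
    by (simp add: roots [symmetric] image_mset.compositionality o_def prod_unfold_prod_mset)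
  finally have "reflect_poly p = smult (lead_coeff p) (\<Prod>i\<in>A. reflect_poly [:- r i, 1:])"
    by (metis reflect_poly_smult reflect_poly_prod)
  moreover have "reflect_poly [:- r i, 1:] = [:1, - r i:]" for i
    by (simp add: reflect_poly_pCons' monom_altdef)
  moreover have "1 + fps_const (- r i) * fps_X = 1 - fps_const (r i) * fps_X" for i
    by (simp only: fps_const_neg [symmetric] mult_minus_left diff_conv_add_uminus)
  ultimately have Q: "Q = fps_const (lead_coeff p) * (\<Prod>i\<in>A. 1 - fps_const (r i) * fps_X)"
    by (simp only: Q_def fps_of_poly_smult fps_of_poly_prod fps_of_poly_linear')
  have "fps_deriv Q = Q * T"
    unfolding Q T_def by (simp add: fps_deriv_prod_one_minus mult.assoc)
  moreover have "Q $ n = 0" if "n \<notin> S" for n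
    using supp that by (simp add: Q_def coeff_reflect_poly)
  moreover have "Q $ 0 \<noteq> 0"
    using \<open>p \<noteq> 0\<close> by (simp add: Q_def)
  moreover obtain n where n: "k = Suc n"
    using \<open>k > 0\<close> by (cases k) auto
  ultimately have "T $ n = 0"
    using fps_log_deriv_support[of S Q T n] closed \<open>k \<notin> S\<close> by blast
  thus ?thesis
    by (simp add: T_def n)
qed

text \<open>
  The part common to gap and pseudo-gap polynomials: \<open>H\<close> is the set of exponents that are
  allowed to occur, and \<open>F\<close> the degree.
\<close>

lemma sum_critical_values_eq_0:
  fixes P :: "complex poly" and r :: "'i \<Rightarrow> complex" and c :: "nat \<Rightarrow> complex"
  assumes P: "P = (\<Sum>g\<in>H. monom (c g) g)"
    and H: "finite H" "F \<in> H" "\<And>g. g \<in> H \<Longrightarrow> g \<le> F" "c F \<noteq> 0"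
    and S: "0 \<in> S" "\<And>a b. a \<in> S \<Longrightarrow> b \<in> S \<Longrightarrow> a + b \<in> S"
    and gaps: "\<And>g. g \<in> H \<Longrightarrow> g \<notin> S"
    and reflect: "\<And>g. g \<in> H \<Longrightarrow> F - g \<in> S"
    and roots: "image_mset r (mset_set A) = proots (pderiv P)"
  shows "(\<Sum>i\<in>A. poly P (r i)) = 0"
proof -
  have coeff_P: "coeff P n = (if n \<in> H then c n else 0)" for n
    using H(1) by (simp add: P coeff_sum)
  have "F > 0"
    using gaps[OF H(2)] S(1) by (cases F) auto
  have "degree P = F"
  proof (rule antisym)
    show "degree P \<le> F"
      using H(3) by (intro degree_le) (auto simp: coeff_P simp flip: not_le)
    show "F \<le> degree P"
      using H(2,4) by (intro le_degree) (simp add: coeff_P)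
  qed
  hence deg: "degree (pderiv P) = F - 1"
    by (simp add: degree_pderiv)
  have nz: "pderiv P \<noteq> 0"
    using \<open>degree P = F\<close> \<open>F > 0\<close> by (auto simp: pderiv_eq_0_iff)
  have "coeff (pderiv P) (degree (pderiv P) - n) = 0"
    if "n \<le> degree (pderiv P)" "n \<notin> S" for n
  proof -
    have "n < F" "Suc (F - 1 - n) = F - n"
      using that(1) \<open>F > 0\<close> by (auto simp: deg)
    moreover have "F - n \<notin> H"
      using reflect[of "F - n"] that(2) \<open>n < F\<close> by auto
    ultimately show ?thesis
      by (simp add: deg coeff_pderiv coeff_P)
  qed
  hence power_sums: "(\<Sum>i\<in>A. r i ^ g) = 0" if "g \<in> H" for g
    using power_sum_proots_eq_0[OF roots S(2) _ nz gaps[OF that]] gaps[OF that] S(1)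
    by (cases g) auto
  have "(\<Sum>i\<in>A. poly P (r i)) = (\<Sum>i\<in>A. \<Sum>g\<in>H. c g * r i ^ g)"
    by (simp add: P poly_sum poly_monom)
  also have "\<dots> = (\<Sum>g\<in>H. c g * (\<Sum>i\<in>A. r i ^ g))"
    by (subst sum.swap) (simp add: sum_distrib_left)
  also have "\<dots> = 0"
    by (simp add: power_sums)
  finally show ?thesis .
qed

theorem corollary3:
  fixes S :: "nat set" and P :: "complex poly" and r :: "nat \<Rightarrow> complex"
  assumes "numerical_semigroup S"
    and "gaps S \<noteq> {}"
    and "(symmetric_semigroup S \<and> gap_polynomial S P) \<or>
         (pseudo_symmetric_semigroup S \<and> pseudo_gap_polynomial S P)"
    and "image_mset r (mset_set {1..Frobenius S - 1}) = proots (pderiv P)"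
  shows "(\<Sum>i = 1..Frobenius S - 1. poly P (r i)) = 0"
proof -
  let ?F = "Frobenius S"
  have S: "0 \<in> S" "\<And>a b. a \<in> S \<Longrightarrow> b \<in> S \<Longrightarrow> a + b \<in> S" and fin: "finite (gaps S)"
    using assms(1) by (auto simp: numerical_semigroup_def gaps_def)
  have F: "?F \<in> gaps S" and le: "\<And>g. g \<in> gaps S \<Longrightarrow> g \<le> ?F"
    using fin assms(2) by (simp_all add: Frobenius_def)
  have gap: "\<And>g. g \<in> gaps S \<Longrightarrow> g \<notin> S"
    by (simp add: gaps_def)
  have "?F \<noteq> 0"
    using gap[OF F] S(1) by metis
  obtain H c where "P = (\<Sum>g\<in>H. monom (c g) g)" "c ?F \<noteq> 0"
    and "H \<subseteq> gaps S" "?F \<in> H" "\<And>g. g \<in> H \<Longrightarrow> ?F - g \<in> S"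
    using assms(3)
  proof (elim disjE conjE)
    assume "symmetric_semigroup S" "gap_polynomial S P"
    thus thesis
      using that[of _ "gaps S"] F by (auto simp: symmetric_semigroup_def gap_polynomial_def)
  next
    assume "pseudo_symmetric_semigroup S" "pseudo_gap_polynomial S P"
    thus thesis
      using that[of _ "gaps S - {?F div 2}"] F \<open>?F \<noteq> 0\<close>
      by (auto simp: pseudo_symmetric_semigroup_def pseudo_gap_polynomial_def)
  qed
  note H = this
  show ?thesis
  proof (rule sum_critical_values_eq_0[OF H(1) _ H(4) _ H(2) S _ H(5) assms(4)])
    show "finite H"
      using H(3) fin by (rule finite_subset)
  qed (use H(3) le gap in auto)
qed

end
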